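(* Let $G$ be a finite group, $\mathbb{K}$ a ring with conjugation $c\mapsto c^*$, and $\alpha$ a twist on $G$. If $V=[G,\alpha,\mathbb{K}]$ and $\alpha$ is proper, then $V$, with its conjugation $x\mapsto x^*$ and inner product $\langle\cdot,\cdot\rangle$, is a proper $*$-algebra; in particular, for all $x,y,z\in V$, $$\langle xy,z\rangle=\langle y,x^*z\rangle\qquad\text{and}\qquad \langle x,yz\rangle=\langle xz^*,y\rangle .$$
   Context: Let $G$ be a finite group with identity $e$. A twist on $G$ is a function $\alpha:G\times G\to\{-1,1\}$ with $\alpha(e,p)=\alpha(p,e)=1$ for all $p\in G$. It is proper if for all $p,q\in G$: (1) $\alpha(p,q)\,\alpha(q,q^{-1})=\alpha(pq,q^{-1})$ and (2) $\alpha(p^{-1},p)\,\alpha(p,q)=\alpha(p^{-1},pq)$. (A proper twist satisfies $\alpha(p,p^{-1})=\alpha(p^{-1},p)$ for all $p$.) $\mathbb{K}$ is a ring with unity carrying a conjugation $c\mapsto c^*$, with $(c^* )^*=c$, $(c+d)^*=c^*+d^*$ and $(cd)^*=d^*c^*$. The twisted group algebra $V=[G,\alpha,\mathbb{K}]$ is the span over $\mathbb{K}$ of a basis $\{i_p\mid p\in G\}$, with elements $x=\sum_p x_p i_p$, $x_p\in\mathbb{K}$, and the product $$xy=\sum_{p,q}\alpha(p,q)\,x_p y_q\, i_{pq}.$$ The conjugate of $x\in V$ is $x^*=\sum_p (x_p)^*\, i_p^{-1}$, where $i_p^{-1}=\alpha(p,p^{-1})\,i_{p^{-1}}$. The inner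 product is $\langle x,y\rangle=\sum_p x_p (y_p)^*$. A proper $*$-algebra is an inner product space (with a product) having an involution $*$ that satisfies the two displayed adjoint properties for all elements $x,y,z$ of the algebra.
   Formalization: ⟨xy,z⟩=⟨y,x*z⟩, and so "proper *-algebra", is stated only for commutative 𝕂: it fails otherwise (x=c·i_e, y=d·i_e, z=i_e gives cd=dc); the rest is for all nonzero 𝕂. "Inner product" means Hermitian, left-linear and nondegenerate, as 𝕂 has no order. *)

theory Defs
  imports "HOL-Analysis.Finite_Cartesian_Product"
begin

text \<open>
  The finite group \<open>G\<close> is a finite type of class \<open>group_add\<close>, the library's class of not
  necessarily commutative groups; its operation is written additively, so \<open>e\<close>, \<open>pq\<close> and the
  inverse of \<open>p\<close> read \<open>0\<close>, \<open>p + q\<close> and \<open>- p\<close>.  The signs of a twist are integers, and act on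
  the scalars through \<open>of_int\<close>.
\<close>

definition twist :: "('g::group_add \<Rightarrow> 'g \<Rightarrow> int) \<Rightarrow> bool" where
  "twist \<alpha> \<longleftrightarrow> (\<forall>p q. \<alpha> p q \<in> {-1, 1}) \<and> (\<forall>p. \<alpha> 0 p = 1 \<and> \<alpha> p 0 = 1)"

definition proper_twist :: "('g::group_add \<Rightarrow> 'g \<Rightarrow> int) \<Rightarrow> bool" where
  "proper_twist \<alpha> \<longleftrightarrow>
     (\<forall>p q. \<alpha> p q * \<alpha> q (- q) = \<alpha> (p + q) (- q)) \<and>
     (\<forall>p q. \<alpha> (- p) p * \<alpha> p q = \<alpha> (- p) (p + q))"

locale ring_conjugation =
  fixes cj :: "'k::ring_1 \<Rightarrow> 'k"
  assumes cj_cj: "cj (cj c) = c"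
    and cj_add: "cj (c + d) = cj c + cj d"
    and cj_mult: "cj (c * d) = cj d * cj c"

text \<open>
  Inner product spaces over a ring with conjugation: left modules with a Hermitian form that
  is linear in the first argument.  An abstract ring with conjugation carries no order, so
  nondegeneracy takes the place of positive definiteness.  The module axioms are spelled out
  because the library locale \<open>module\<close> presupposes commutative scalars.
\<close>

locale conj_inner_product_space = ring_conjugation cj
  for cj :: "'k::ring_1 \<Rightarrow> 'k" +
  fixes scale :: "'k \<Rightarrow> 'v::ab_group_add \<Rightarrow> 'v"
    and ip :: "'v \<Rightarrow> 'v \<Rightarrow> 'k"
  assumes scale_right_distrib: "scale c (x + y) = scale c x + scale c y"
    and scale_left_distrib: "scale (c + d) x = scale c x + scale d x"
    and scale_scale: "scale c (scale d x) = scale (c * d) x"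
    and scale_one: "scale 1 x = x"
    and ip_add_left: "ip (x + y) z = ip x z + ip y z"
    and ip_scale_left: "ip (scale c x) y = c * ip x y"
    and ip_commute: "ip y x = cj (ip x y)"
    and ip_nondegenerate: "(\<And>y. ip x y = 0) \<Longrightarrow> x = 0"

text \<open>
  Inner product spaces with a product (not assumed associative or unital) and an involution;
  these axioms make sense for noncommutative scalars.
\<close>

locale involutive_inner_product_algebra = conj_inner_product_space cj scale ip
  for cj :: "'k::ring_1 \<Rightarrow> 'k" and scale :: "'k \<Rightarrow> 'v::ab_group_add \<Rightarrow> 'v"
    and ip :: "'v \<Rightarrow> 'v \<Rightarrow> 'k" +
  fixes prod :: "'v \<Rightarrow> 'v \<Rightarrow> 'v"
    and star :: "'v \<Rightarrow> 'v"
  assumes prod_add_left: "prod (x + y) z = prod x z + prod y z"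
    and prod_add_right: "prod x (y + z) = prod x y + prod x z"
    and prod_scale_left: "prod (scale c x) y = scale c (prod x y)"
    and star_star: "star (star x) = x"
    and star_add: "star (x + y) = star x + star y"
    and star_prod: "star (prod x y) = prod (star y) (star x)"

locale proper_star_algebra = involutive_inner_product_algebra cj scale ip prod star
  for cj :: "'k::ring_1 \<Rightarrow> 'k" and scale :: "'k \<Rightarrow> 'v::ab_group_add \<Rightarrow> 'v"
    and ip :: "'v \<Rightarrow> 'v \<Rightarrow> 'k" and prod :: "'v \<Rightarrow> 'v \<Rightarrow> 'v" and star :: "'v \<Rightarrow> 'v" +
  assumes prod_scale_right: "prod x (scale c y) = scale c (prod x y)"
    and star_scale: "star (scale c x) = scale (cj c) (star x)"
    and adjoint_left: "ip (prod x y) z = ip y (prod (star x) z)"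
    and adjoint_right: "ip x (prod y z) = ip (prod x (star z)) y"

text \<open>
  The twisted group algebra has \<open>'k ^ 'g\<close> as its underlying module; \<open>x $ p\<close> is the coefficient
  of \<open>x\<close> at the basis vector of \<open>p\<close>.
\<close>

definition bvec :: "'g::finite \<Rightarrow> 'k::ring_1 ^ 'g" where
  "bvec p = axis p 1"

definition bvec_inv :: "('g::{group_add,finite} \<Rightarrow> 'g \<Rightarrow> int) \<Rightarrow> 'g \<Rightarrow> ('k::ring_1, 'g) vec" where
  "bvec_inv \<alpha> p = of_int (\<alpha> p (- p)) *s bvec (- p)"

definition twisted_prod ::
  "('g::{group_add,finite} \<Rightarrow> 'g \<Rightarrow> int) \<Rightarrow> ('k::ring_1, 'g) vec \<Rightarrow> ('k, 'g) vec \<Rightarrow> ('k, 'g) vec" where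
  "twisted_prod \<alpha> x y =
     (\<Sum>p\<in>UNIV. \<Sum>q\<in>UNIV. (of_int (\<alpha> p q) * x $ p * y $ q) *s bvec (p + q))"

definition twisted_star ::
  "('k::ring_1 \<Rightarrow> 'k) \<Rightarrow> ('g::{group_add,finite} \<Rightarrow> 'g \<Rightarrow> int) \<Rightarrow> ('k, 'g) vec \<Rightarrow> ('k, 'g) vec" where
  "twisted_star cj \<alpha> x = (\<Sum>p\<in>UNIV. cj (x $ p) *s bvec_inv \<alpha> p)"

definition twisted_inner :: "('k::ring_1 \<Rightarrow> 'k) \<Rightarrow> 'k ^ 'g::finite \<Rightarrow> 'k ^ 'g \<Rightarrow> 'k" where
  "twisted_inner cj x y = (\<Sum>p\<in>UNIV. x $ p * cj (y $ p))"

text \<open>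
  The first adjoint identity forces the scalars to commute: take \<open>x\<close>, \<open>y\<close>, \<open>z\<close> to be \<open>c\<close>, \<open>d\<close>, \<open>1\<close>
  times the basis vector of the identity.
\<close>

lemma adjoint_left_imp_commute:
  fixes cj :: "'k::ring_1 \<Rightarrow> 'k" and \<alpha> :: "'g::{group_add,finite} \<Rightarrow> 'g \<Rightarrow> int"
  assumes "ring_conjugation cj" and "twist \<alpha>"
    and adj: "\<And>x y z. twisted_inner cj (twisted_prod \<alpha> x y) z =
                       twisted_inner cj y (twisted_prod \<alpha> (twisted_star cj \<alpha> x) z)"
  shows "c * d = d * (c :: 'k)"
proof -
  interpret ring_conjugation cj by fact
  have cj0: "cj 0 = 0" using cj_add[of 0 0] by simp
  have cj1: "cj 1 = 1" using cj_mult[of "cj 1" 1] by (simp add: cj_cj)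
  have \<alpha>0: "\<alpha> 0 0 = 1" using assms(2) by (simp add: twist_def)
  let ?b = "\<lambda>c. axis 0 c :: ('k, 'g) vec"
  have delta: "(\<Sum>p\<in>UNIV. if p = (0::'g) then f p else 0) = f 0" for f :: "'g \<Rightarrow> 'v::comm_monoid_add"
    by (simp add: sum.delta')
  have ax: "axis (0::'g) (a::'k) $ p = (if p = 0 then a else 0)" for a p
    by (simp add: axis_def)
  have sc: "a *s axis (0::'g) (1::'k) = axis 0 a" for a
    by (simp add: vec_eq_iff ax)
  have z: "(0::'k) *s (v::('k, 'g) vec) = 0" for v by (simp add: vec_eq_iff)
  have prod: "twisted_prod \<alpha> (?b a) (?b b) = ?b (a * b)" for a b
  proof -
    have "twisted_prod \<alpha> (?b a) (?b b) =
      (\<Sum>p\<in>UNIV. \<Sum>q\<in>UNIV. if q = (0::'g) then (if p = (0::'g) then ?b (a * b) else 0) else 0)"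
      unfolding twisted_prod_def
      by (intro sum.cong refl) (auto simp: ax bvec_def \<alpha>0 sc z)
    then show ?thesis by (simp add: delta)
  qed
  have star: "twisted_star cj \<alpha> (?b a) = ?b (cj a)" for a
  proof -
    have "twisted_star cj \<alpha> (?b a) = (\<Sum>p\<in>UNIV. if p = (0::'g) then ?b (cj a) else 0)"
      unfolding twisted_star_def
      by (intro sum.cong refl) (auto simp: ax bvec_def bvec_inv_def \<alpha>0 sc z cj0)
    then show ?thesis by (simp add: delta)
  qed
  have inner: "twisted_inner cj (?b a) (?b b) = a * cj b" for a b
  proof -
    have "twisted_inner cj (?b a) (?b b) = (\<Sum>p\<in>UNIV. if p = (0::'g) then a * cj b else 0)"
      unfolding twisted_inner_def by (intro sum.cong refl) (auto simp: ax)
    then show ?thesis by (simp add: delta)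
  qed
  show ?thesis
    using adj[of "?b c" "?b d" "?b 1"] by (simp add: prod star inner cj_cj cj1)
qed

end

theory Submission
  imports Defs
begin

text \<open>
  All signs being square roots of 1, properness moves any factor \<open>\<alpha> p (- p)\<close> across an equation.
  Comparing coefficients and reindexing by the group, each identity for the product reduces to one
  between signs; the right adjoint identity and the star of a product keep the scalars in order,
  and only the left adjoint identity moves them past each other.
\<close>

section \<open>Conjugation of integers and sums in the scalar ring\<close>

lemma (in ring_conjugation) cj_0: "cj 0 = 0"
  using cj_add[of 0 0] by simp

lemma (in ring_conjugation) cj_1: "cj 1 = 1"
  \<comment> \<open>Conjugating \<open>cj 1 * 1\<close> gives 1 by involutivity and
    \<open>cj 1\<close> by reversal of products.\<close>
  using cj_mult[of "cj 1" 1] by (simp add: cj_cj)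

lemma (in ring_conjugation) cj_uminus: "cj (- c) = - cj c"
  using cj_add[of c "- c"] by (simp add: cj_0 eq_neg_iff_add_eq_0 add.commute)

lemma (in ring_conjugation) cj_sum: "cj (\<Sum>a\<in>A. f a) = (\<Sum>a\<in>A. cj (f a))"
  by (induction A rule: infinite_finite_induct) (simp_all add: cj_0 cj_add)

text \<open>Lets the signs of a twist leave a conjugation unchanged: integers are generated
  additively by 1, which is fixed.\<close>

lemma (in ring_conjugation) cj_of_int: "cj (of_int k) = of_int k"
proof -
  have "cj (of_nat n) = of_nat n" for n
    by (induction n) (simp_all add: cj_0 cj_1 cj_add)
  then show ?thesis
    by (cases k rule: int_cases2) (simp_all add: cj_uminus)
qed

text \<open>
  Simplification rules gathering all signs in front of a product; the \<open>NO_MATCH\<close> guards prevent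
  two signs from being swapped forever.
\<close>

lemma of_int_collect_left:
  fixes x y :: "'k::ring_1"
  shows "NO_MATCH (of_int j) x \<Longrightarrow> x * of_int k = of_int k * x"
    and "NO_MATCH (of_int j) x \<Longrightarrow> x * (of_int k * y) = of_int k * (x * y)"
    and "of_int i * of_int k = (of_int (i * k) :: 'k)"
    and "of_int i * (of_int k * y) = of_int (i * k) * y"
proof -
  show "x * of_int k = of_int k * x"
    by (rule mult_of_int_commute[symmetric])
  then show "x * (of_int k * y) = of_int k * (x * y)"
    by (metis mult.assoc)
qed (simp_all add: mult.assoc)

lemma sum_mult_delta_left:
  fixes f :: "'a::finite \<Rightarrow> 'k::ring_1"
  shows "(\<Sum>a\<in>UNIV. f a * (if a = b then 1 else 0)) = f b"
  by (simp add: if_distrib[of "(*) _"] cong: if_cong)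

section \<open>Coefficients of product and star\<close>

lemma twisted_prod_nth:
  fixes x y :: "('k::ring_1, 'g::{group_add,finite}) vec"
  shows "twisted_prod \<alpha> x y $ r = (\<Sum>p\<in>UNIV. of_int (\<alpha> p (- p + r)) * x $ p * y $ (- p + r))"
proof -
  \<comment> \<open>For fixed \<open>p\<close>, exactly one \<open>q\<close> contributes to the
    coefficient at \<open>r\<close>, so the inner sum collapses.\<close>
  have "r = p + q \<longleftrightarrow> q = - p + r" for p q :: 'g
    by (metis add.assoc add.left_inverse add.right_inverse add_0)
  then show ?thesis
    by (simp add: twisted_prod_def bvec_def axis_def sum_mult_delta_left)
qed

lemma twisted_star_nth:
  fixes x :: "('k::ring_1, 'g::{group_add,finite}) vec"
  shows "twisted_star cj \<alpha> x $ p = cj (x $ (- p)) * of_int (\<alpha> (- p) p)"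
proof -
  have "p = - q \<longleftrightarrow> q = - p" for q :: 'g
    by auto
  then show ?thesis
    by (simp add: twisted_star_def bvec_inv_def bvec_def axis_def mult.assoc[symmetric]
        sum_mult_delta_left)
qed

section \<open>Sign identities of a proper twist\<close>

lemma twist_square: "twist \<alpha> \<Longrightarrow> \<alpha> p q * \<alpha> p q = 1"
  unfolding twist_def by (metis insertE mult_1 mult_minus1 minus_minus singletonD)

lemma proper_twist_right: "proper_twist \<alpha> \<Longrightarrow> \<alpha> p q * \<alpha> q (- q) = \<alpha> (p + q) (- q)"
  by (simp add: proper_twist_def)

lemma proper_twist_left: "proper_twist \<alpha> \<Longrightarrow> \<alpha> (- p) p * \<alpha> p q = \<alpha> (- p) (p + q)"
  by (simp add: proper_twist_def)

lemma proper_twist_inverse_commute: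
  assumes "twist \<alpha>" "proper_twist \<alpha>"
  shows "\<alpha> (- p) p = \<alpha> p (- p)"
proof -
  \<comment> \<open>The right axiom at \<open>- p\<close>, \<open>p\<close> ends in
    \<open>\<alpha> 0 (- p)\<close>, which is 1; two signs with product 1 agree.\<close>
  have "\<alpha> (- p) p * \<alpha> p (- p) = 1"
    using proper_twist_right[OF assms(2), of "- p" p] assms(1) by (simp add: twist_def)
  then show ?thesis
    using twist_square[OF assms(1), of p "- p"] by (metis mult.assoc mult_1 mult_1_right)
qed

text \<open>The two sides are the signs at coefficient \<open>r\<close> of the star of a product and
  of the reversed product of stars, the latter at summation index \<open>r + p\<close>.\<close>

lemma proper_twist_star_prod:
  assumes "twist \<alpha>" "proper_twist \<alpha>"
  shows "\<alpha> p (- p - r) * \<alpha> (- r) r = \<alpha> (r + p) (- p) * \<alpha> (- p - r) (r + p) * \<alpha> p (- p)"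
proof -
  have 1: "\<alpha> (r + p) (- p) * \<alpha> p (- p) = \<alpha> r p"
    using proper_twist_right[OF assms(2), of r p, symmetric] twist_square[OF assms(1), of p "- p"]
    by (simp add: mult.assoc)
  \<comment> \<open>The left axiom merges the first two signs into
    \<open>\<alpha> (- r) (r + p)\<close>; the right axiom then absorbs the third.\<close>
  have "\<alpha> (- r) r * \<alpha> r p * \<alpha> (r + p) (- p - r) = \<alpha> p (- p - r)"
    using proper_twist_left[OF assms(2), of r p]
      proper_twist_right[OF assms(2), of "- r" "r + p"]
    by (simp add: minus_add diff_conv_add_uminus add.assoc[symmetric] del: add_uminus_conv_diff)
  then have "\<alpha> (- r) r * \<alpha> p (- p - r) = (\<alpha> (- r) r * \<alpha> (- r) r) * \<alpha> r p * \<alpha> (r + p) (- p - r)"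
    by (simp add: mult.assoc)
  also have "\<dots> = \<alpha> r p * \<alpha> (- p - r) (r + p)"
    using proper_twist_inverse_commute[OF assms, of "r + p"] twist_square[OF assms(1), of "- r" r]
    by (simp add: minus_add)
  finally show ?thesis
    using 1 by (simp add: ac_simps)
qed

section \<open>The involution and the adjoint identities\<close>

lemma twisted_star_star:
  fixes x :: "('k::ring_1, 'g::{group_add,finite}) vec"
  assumes "ring_conjugation cj" "twist \<alpha>" "proper_twist \<alpha>"
  shows "twisted_star cj \<alpha> (twisted_star cj \<alpha> x) = x"
proof -
  interpret ring_conjugation cj by fact
  have "\<alpha> p (- p) * \<alpha> (- p) p = 1" for p
    using proper_twist_inverse_commute[OF assms(2,3), of p] twist_square[OF assms(2), of p "- p"]
    by simp
  then show ?thesis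
    by (simp add: vec_eq_iff twisted_star_nth cj_mult cj_cj cj_of_int of_int_collect_left ac_simps
        del: of_int_mult)
qed

lemma twisted_star_prod:
  fixes x y :: "('k::ring_1, 'g::{group_add,finite}) vec"
  assumes "ring_conjugation cj" "twist \<alpha>" "proper_twist \<alpha>"
  shows "twisted_star cj \<alpha> (twisted_prod \<alpha> x y) =
         twisted_prod \<alpha> (twisted_star cj \<alpha> y) (twisted_star cj \<alpha> x)"
proof -
  interpret ring_conjugation cj by fact
  have "twisted_star cj \<alpha> (twisted_prod \<alpha> x y) $ r =
        twisted_prod \<alpha> (twisted_star cj \<alpha> y) (twisted_star cj \<alpha> x) $ r" for r
  proof -
    let ?c = "\<lambda>p. cj (y $ (- p - r)) * cj (x $ p)"
    have "twisted_star cj \<alpha> (twisted_prod \<alpha> x y) $ r =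
      (\<Sum>p\<in>UNIV. of_int (\<alpha> p (- p - r) * \<alpha> (- r) r) * ?c p)"
      by (simp add: twisted_star_nth twisted_prod_nth cj_sum cj_mult cj_of_int sum_distrib_right
          mult.assoc of_int_collect_left del: of_int_mult)
    also have "\<dots> =
      (\<Sum>p\<in>UNIV. of_int (\<alpha> (r + p) (- p) * \<alpha> (- p - r) (r + p) * \<alpha> p (- p)) * ?c p)"
      by (simp only: proper_twist_star_prod[OF assms(2,3)])
    \<comment> \<open>With \<open>q = r + p\<close>, the indices \<open>- q + r\<close> and
      \<open>- q\<close> become \<open>- p\<close> and \<open>- p - r\<close>.\<close>
    also have "\<dots> = (\<Sum>q\<in>UNIV. of_int (\<alpha> q (- q + r)) *
        (cj (y $ (- q)) * of_int (\<alpha> (- q) q)) *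
        (cj (x $ (- (- q + r))) * of_int (\<alpha> (- (- q + r)) (- q + r))))"
      by (rule sum.reindex_bij_witness[of _ "\<lambda>q. - r + q" "\<lambda>p. r + p"])
        (simp_all add: minus_add mult.assoc of_int_collect_left add.assoc
          diff_conv_add_uminus del: add_uminus_conv_diff of_int_mult)
    finally show ?thesis
      by (simp add: twisted_prod_nth twisted_star_nth)
  qed
  then show ?thesis
    by (simp add: vec_eq_iff)
qed

text \<open>Since \<open>cj\<close> reverses the product of the coefficients of \<open>y\<close> and
  \<open>z\<close>, both sides carry the scalars in the order \<open>x\<close>, \<open>z\<close>,
  \<open>y\<close>. Exchanging the two sums aligns the indices.\<close>

lemma twisted_inner_adjoint_right:
  fixes x y z :: "('k::ring_1, 'g::{group_add,finite}) vec"
  assumes "ring_conjugation cj" "twist \<alpha>" "proper_twist \<alpha>"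
  shows "twisted_inner cj x (twisted_prod \<alpha> y z) =
         twisted_inner cj (twisted_prod \<alpha> x (twisted_star cj \<alpha> z)) y"
proof -
  interpret ring_conjugation cj by fact
  let ?c = "\<lambda>p r. x $ r * (cj (z $ (- p + r)) * cj (y $ p))"
  \<comment> \<open>The right axiom at \<open>p\<close>, \<open>- p + r\<close>, whose sum is
    \<open>r\<close>, with one sign moved across.\<close>
  have sign: "\<alpha> p (- p + r) = \<alpha> r (- r + p) * \<alpha> (- p + r) (- r + p)" for p r
    using proper_twist_right[OF assms(3), of p "- p + r", symmetric]
      twist_square[OF assms(2), of "- p + r" "- r + p"]
    by (simp add: minus_add mult.assoc add.assoc[symmetric])
  have "twisted_inner cj x (twisted_prod \<alpha> y z) =
      (\<Sum>r\<in>UNIV. \<Sum>p\<in>UNIV. of_int (\<alpha> p (- p + r)) * ?c p r)"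
    by (simp add: twisted_inner_def twisted_prod_nth cj_sum cj_mult cj_of_int sum_distrib_left
        mult.assoc of_int_collect_left del: of_int_mult)
  also have "\<dots> = (\<Sum>p\<in>UNIV. \<Sum>r\<in>UNIV.
      of_int (\<alpha> r (- r + p) * \<alpha> (- p + r) (- r + p)) * ?c p r)"
    by (subst sum.swap) (simp only: sign[symmetric])
  also have "\<dots> = twisted_inner cj (twisted_prod \<alpha> x (twisted_star cj \<alpha> z)) y"
    by (simp add: twisted_inner_def twisted_prod_nth twisted_star_nth sum_distrib_right
        mult.assoc of_int_collect_left minus_add del: of_int_mult)
  finally show ?thesis .
qed

text \<open>The left side has scalars in the order \<open>x\<close>, \<open>y\<close>,
  \<open>z\<close>, the right side in the order \<open>y\<close>, \<open>z\<close>,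
  \<open>x\<close>: the coefficient of \<open>x\<close> must pass the other two.\<close>

lemma twisted_inner_adjoint_left:
  fixes x y z :: "('k::ring_1, 'g::{group_add,finite}) vec"
  assumes "ring_conjugation cj" "twist \<alpha>" "proper_twist \<alpha>"
    and commute: "\<And>c d :: 'k. c * d = d * c"
  shows "twisted_inner cj (twisted_prod \<alpha> x y) z =
         twisted_inner cj y (twisted_prod \<alpha> (twisted_star cj \<alpha> x) z)"
proof -
  interpret ring_conjugation cj by fact
  have left_commute: "a * (b * c) = b * (a * c)" for a b c :: 'k
    by (metis mult.assoc commute)
  let ?c = "\<lambda>p s. x $ p * (y $ s * cj (z $ (p + s)))"
  have sign: "\<alpha> p s = \<alpha> (- p) (p + s) * \<alpha> p (- p)" for p s
    using proper_twist_left[OF assms(3), of p s, symmetric] twist_square[OF assms(2), of p "- p"]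
      proper_twist_inverse_commute[OF assms(2,3), of p]
    by (simp add: ac_simps)
  have "twisted_inner cj (twisted_prod \<alpha> x y) z = (\<Sum>p\<in>UNIV. \<Sum>r\<in>UNIV.
      of_int (\<alpha> p (- p + r)) * x $ p * y $ (- p + r) * cj (z $ r))"
    by (subst sum.swap) (simp add: twisted_inner_def twisted_prod_nth sum_distrib_right)
  also have "\<dots> = (\<Sum>p\<in>UNIV. \<Sum>s\<in>UNIV. of_int (\<alpha> p s) * ?c p s)"
  proof (rule sum.cong[OF refl])
    fix p
    show "(\<Sum>r\<in>UNIV. of_int (\<alpha> p (- p + r)) * x $ p * y $ (- p + r) * cj (z $ r)) =
        (\<Sum>s\<in>UNIV. of_int (\<alpha> p s) * ?c p s)"
      by (rule sum.reindex_bij_witness[of _ "\<lambda>s. p + s" "\<lambda>r. - p + r"])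
        (simp_all add: mult.assoc add.assoc[symmetric])
  qed
  also have "\<dots> = (\<Sum>s\<in>UNIV. \<Sum>p\<in>UNIV. of_int (\<alpha> (- p) (p + s) * \<alpha> p (- p)) * ?c p s)"
    by (subst sum.swap) (simp only: sign[symmetric])
  \<comment> \<open>The substitution \<open>q = - p\<close> is forced by the star, which reads
    \<open>x\<close> at the inverse index.\<close>
  also have "\<dots> = (\<Sum>s\<in>UNIV. \<Sum>q\<in>UNIV. y $ s *
      cj (of_int (\<alpha> q (- q + s)) * (cj (x $ (- q)) * of_int (\<alpha> (- q) q)) * z $ (- q + s)))"
    by (rule sum.cong[OF refl], rule sum.reindex_bij_witness[of _ uminus uminus])
      (simp_all add: cj_mult cj_cj cj_of_int mult.assoc commute left_commute)
  also have "\<dots> = twisted_inner cj y (twisted_prod \<alpha> (twisted_star cj \<alpha> x) z)"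
    by (simp add: twisted_inner_def twisted_prod_nth twisted_star_nth cj_sum sum_distrib_left)
  finally show ?thesis .
qed

section \<open>Assembling the algebra structures\<close>

lemma twisted_involutive_inner_product_algebra:
  fixes cj :: "'k::ring_1 \<Rightarrow> 'k" and \<alpha> :: "'g::{group_add,finite} \<Rightarrow> 'g \<Rightarrow> int"
  assumes "ring_conjugation cj" "twist \<alpha>" "proper_twist \<alpha>"
  shows "involutive_inner_product_algebra cj (*s) (twisted_inner cj)
           (twisted_prod \<alpha>) (twisted_star cj \<alpha>)"
proof -
  interpret ring_conjugation cj by fact
  show ?thesis
  proof (unfold_locales, goal_cases)
    case (8 x)
    \<comment> \<open>Nondegeneracy: pairing with basis vectors recovers every coefficient.\<close>
    have "x $ p = twisted_inner cj x (axis p 1)" for p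
      by (simp add: twisted_inner_def axis_def if_distrib[of cj] cj_0 cj_1 sum_mult_delta_left
          cong: if_cong)
    then show ?case
      using 8 by (simp add: vec_eq_iff)
  next
    case 12
    show ?case by (rule twisted_star_star[OF assms])
  next
    case 14
    show ?case by (rule twisted_star_prod[OF assms])
  qed (simp_all add: vec_eq_iff twisted_inner_def twisted_prod_nth twisted_star_nth cj_cj cj_add
      cj_mult cj_sum distrib_left distrib_right sum.distrib sum_distrib_left mult.assoc
      of_int_collect_left del: of_int_mult)
qed

theorem theorem5p10:
  fixes cj :: "'k::ring_1 \<Rightarrow> 'k"
    and \<alpha> :: "'g::{group_add,finite} \<Rightarrow> 'g \<Rightarrow> int"
  assumes "ring_conjugation cj"
    and "twist \<alpha>"
    and "proper_twist \<alpha>"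
  shows "involutive_inner_product_algebra cj (*s)
           (twisted_inner cj :: ('k, 'g) vec \<Rightarrow> ('k, 'g) vec \<Rightarrow> 'k)
           (twisted_prod \<alpha>) (twisted_star cj \<alpha>) \<and>
         (\<forall>x y z :: ('k, 'g) vec.
            twisted_inner cj x (twisted_prod \<alpha> y z) =
            twisted_inner cj (twisted_prod \<alpha> x (twisted_star cj \<alpha> z)) y) \<and>
         ((\<forall>c d :: 'k. c * d = d * c) \<longrightarrow>
            proper_star_algebra cj (*s)
              (twisted_inner cj :: ('k, 'g) vec \<Rightarrow> ('k, 'g) vec \<Rightarrow> 'k)
              (twisted_prod \<alpha>) (twisted_star cj \<alpha>) \<and>
            (\<forall>x y z :: ('k, 'g) vec.
               twisted_inner cj (twisted_prod \<alpha> x y) z =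
               twisted_inner cj y (twisted_prod \<alpha> (twisted_star cj \<alpha> x) z)))"
proof (intro conjI allI impI)
  show alg: "involutive_inner_product_algebra cj (*s)
      (twisted_inner cj :: ('k, 'g) vec \<Rightarrow> ('k, 'g) vec \<Rightarrow> 'k)
      (twisted_prod \<alpha>) (twisted_star cj \<alpha>)"
    by (rule twisted_involutive_inner_product_algebra[OF assms])
  show right: "twisted_inner cj x (twisted_prod \<alpha> y z) =
      twisted_inner cj (twisted_prod \<alpha> x (twisted_star cj \<alpha> z)) y" for x y z :: "('k, 'g) vec"
    by (rule twisted_inner_adjoint_right[OF assms])
  \<comment> \<open>The assumption is unavoidable here: by \<open>adjoint_left_imp_commute\<close>,
    the left adjoint identity implies it.\<close>
  assume commute: "\<forall>c d :: 'k. c * d = d * c"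
  then have left_commute: "a * (b * c) = b * (a * c)" for a b c :: 'k
    by (metis mult.assoc)
  show left: "twisted_inner cj (twisted_prod \<alpha> x y) z =
      twisted_inner cj y (twisted_prod \<alpha> (twisted_star cj \<alpha> x) z)" for x y z :: "('k, 'g) vec"
    by (rule twisted_inner_adjoint_left[OF assms]) (simp add: commute)
  interpret involutive_inner_product_algebra cj "(*s)"
    "twisted_inner cj :: ('k, 'g) vec \<Rightarrow> ('k, 'g) vec \<Rightarrow> 'k" "twisted_prod \<alpha>" "twisted_star cj \<alpha>"
    by (rule alg)
  show "proper_star_algebra cj (*s)
      (twisted_inner cj :: ('k, 'g) vec \<Rightarrow> ('k, 'g) vec \<Rightarrow> 'k)
      (twisted_prod \<alpha>) (twisted_star cj \<alpha>)"
  \<comment> \<open>In the first two goals commutativity moves a scalar past a coefficient: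
    \<open>c\<close> past that of \<open>x\<close> in the product, and \<open>cj c\<close> past the
    conjugated coefficient in the star.\<close>
  proof (unfold_locales, goal_cases)
    case (1 x c y)
    show ?case
      by (simp add: vec_eq_iff twisted_prod_nth sum_distrib_left mult.assoc left_commute)
  next
    case (2 c x)
    show ?case
      by (simp add: vec_eq_iff twisted_star_nth cj_mult mult.assoc left_commute)
  next
    case (3 x y z)
    show ?case by (rule left)
  next
    case (4 x y z)
    show ?case by (rule right)
  qed
qed

end
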